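(* Let $d\ge1$ and let $a:\mathbb R^d\to[0,\infty)$ be a bounded, continuous, even, integrable function with $\int_{\mathbb R^d}a(x)\,dx=1$. Suppose that there are constants $c>0$ and $\delta>0$ with $$a(x)\le c\,e^{-\delta|x|}\quad\text{for all }x\in\mathbb R^d .$$ For $\lambda>0$ let $G_\lambda(x)=\sum_{k=1}^\infty(1+\lambda)^{-k}a_k(x)$, where $a_k=a^{*k}$ is the $k$-fold convolution of $a$ with itself. Then there exist positive constants $k(\lambda)$ and $m(\lambda)$, $\lambda>0$, such that $$G_\lambda(x)\le k(\lambda)\,e^{-m(\lambda)|x|}\quad\text{for all }x\in\mathbb R^d,\ \lambda>0,$$ and moreover $k(\lambda)\to\infty$ and $m(\lambda)=O(\lambda)$ as $\lambda\to0^+$.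
   Context: The convolution powers are $a_1=a$ and $a_{k+1}(x)=\int_{\mathbb R^d}a(x-y)a_k(y)\,dy$. The function $G_\lambda$ arises from the resolvent of the operator $(L_0u)(x)=\int_{\mathbb R^d}a(x-y)(u(y)-u(x))\,dy$: the kernel of $(\lambda-L_0)^{-1}$ is $(1+\lambda)^{-1}(\delta(x-y)+G_\lambda(x-y))$. *)

theory Defs
  imports "HOL-Analysis.Analysis" "HOL-Library.Landau_Symbols"
begin

(* The 0-th convolution power would be the Dirac measure, which is not a function;
   the value at 0 is a dummy that is never used below. *)
fun conv_power :: "(real ^ 'n \<Rightarrow> real) \<Rightarrow> nat \<Rightarrow> real ^ 'n \<Rightarrow> real" where
  "conv_power a 0 = (\<lambda>x. 0)"
| "conv_power a (Suc 0) = a"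
| "conv_power a (Suc (Suc k)) =
     (\<lambda>x. LINT y|lborel. a (x - y) * conv_power a (Suc k) y)"

(* The sum over k = 1, 2, ... is written with shifted index.  For bounded a \<ge> 0 of
   total mass 1 and lambda > 0 the series converges, as 0 \<le> a_k \<le> sup a for all k. *)
definition resolvent_kernel :: "(real ^ 'n \<Rightarrow> real) \<Rightarrow> real \<Rightarrow> real ^ 'n \<Rightarrow> real" where
  "resolvent_kernel a lam x = (\<Sum>k. conv_power a (Suc k) x / (1 + lam) ^ Suc k)"

end

theory Submission
  imports Defs
begin

text \<open>
  Put \<open>M s = \<integral> a(y) exp(s\<bar>y\<bar>) dy\<close>, finite for \<open>s < \<delta>\<close>. Since \<open>\<bar>x\<bar> \<le> \<bar>x - y\<bar> + \<bar>y\<bar>\<close>, conjugating the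
  convolution with the weight \<open>exp(s\<bar>x\<bar>)\<close> gives \<open>a\<^sub>k(x) exp(s\<bar>x\<bar>) \<le> c M(s)^(k-1)\<close> by induction. By
  dominated convergence \<open>M s\<close> tends to \<open>1\<close> as \<open>s\<close> tends to \<open>0\<close>, so for each \<open>\<lambda>\<close> some \<open>s < \<lambda>\<close> has
  \<open>M s < 1 + \<lambda>/2\<close>, and the geometric series yields the bound with \<open>m(\<lambda>) = s\<close> and \<open>k(\<lambda>) = 2c/\<lambda>\<close>.
\<close>

text \<open>The half-line integral is known, and reflection carries it to the other half-line. The
  sum of the two halves dominates the integrand, with equality except at 0, where both halves
  contribute.\<close>

lemma integrable_exp_neg_abs:
  fixes e :: real
  assumes "e > 0"
  shows "integrable lborel (\<lambda>t::real. exp (- e * \<bar>t\<bar>))"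
proof -
  have "(\<lambda>t. exp (- e * t)) absolutely_integrable_on {0..}"
    using integrable_on_exp_minus_to_infinity[OF assms, of 0]
    by (intro nonnegative_absolutely_integrable_1) auto
  then have int: "integrable lborel (\<lambda>t. indicator {0..} t * exp (- e * t))"
    by (simp add: set_integrable_def integrable_completion)
  have "integrable lborel (\<lambda>t. indicator {0..} (-t) * exp (- e * (-t)))"
    using lborel_integrable_real_affine[OF int, of "-1" 0] by simp
  from Bochner_Integration.integrable_add[OF int this] show ?thesis
    by (rule Bochner_Integration.integrable_bound) (auto simp: indicator_def)
qed

text \<open>The sum of the absolute coordinates is at most the dimension times the norm. Splitting
  the rate \<open>e\<close> evenly over the coordinates thus bounds the function by a product of
  one-dimensional exponentials, whose integral factorises.\<close>

lemma integrable_exp_neg_norm: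
  fixes e :: real
  assumes "e > 0"
  shows "integrable lborel (\<lambda>x::'a::euclidean_space. exp (- e * norm x))"
proof -
  define d where "d = e / DIM('a)"
  have "d > 0" using assms by (simp add: d_def)
  let ?g = "\<lambda>x::'a. \<Prod>b\<in>Basis. exp (- d * \<bar>x \<bullet> b\<bar>)"
  have fin: "(\<integral>\<^sup>+t. ennreal (exp (- d * \<bar>t\<bar>)) \<partial>lborel) < \<infinity>"
    using integrable_exp_neg_abs[OF \<open>d > 0\<close>] by (simp add: integrable_iff_bounded)
  have "(\<integral>\<^sup>+x. ennreal (?g x) \<partial>lborel)
      = (\<Prod>b\<in>(Basis::'a set). \<integral>\<^sup>+t. ennreal (exp (- d * \<bar>t\<bar>)) \<partial>lborel)"
    using nn_integral_lborel_prod[where f="\<lambda>b t. ennreal (exp (- d * \<bar>t\<bar>))" and 'a='a]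
    by (simp add: prod_ennreal)
  also have "\<dots> < \<infinity>"
    using fin by (simp add: power_less_top_ennreal)
  finally have "integrable lborel ?g"
    by (simp add: integrable_iff_bounded abs_prod)
  moreover have "exp (- e * norm x) \<le> ?g x" for x :: 'a
  proof -
    have "d * (\<Sum>b\<in>Basis. \<bar>x \<bullet> b\<bar>) \<le> d * (\<Sum>b\<in>(Basis::'a set). norm x)"
      using \<open>d > 0\<close> by (intro mult_left_mono sum_mono Basis_le_norm) auto
    also have "\<dots> = e * norm x"
      by (simp add: d_def)
    finally show ?thesis
      by (simp add: exp_sum[symmetric] sum_distrib_left sum_negf)
  qed
  ultimately show ?thesis
    by (elim Bochner_Integration.integrable_bound) (auto simp: abs_prod)
qed

lemma lborel_integrable_translation:
  fixes f :: "'a::euclidean_space \<Rightarrow> real"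
  assumes "integrable lborel f"
  shows "integrable lborel (\<lambda>y. f (t + y))"
proof -
  have "integrable (distr lborel borel ((+) t)) f"
    using assms by (simp add: lborel_distr_plus)
  then show ?thesis
    by (subst (asm) integrable_distr_eq) (use assms in auto)
qed

lemma lborel_integral_translation:
  fixes f :: "'a::euclidean_space \<Rightarrow> real"
  assumes "f \<in> borel_measurable borel"
  shows "(LINT y|lborel. f (t + y)) = (LINT y|lborel. f y)"
proof -
  have "(LINT y|lborel. f y) = (LINT y|distr lborel borel ((+) t). f y)"
    by (simp add: lborel_distr_plus)
  also have "\<dots> = (LINT y|lborel. f (t + y))"
    by (subst integral_distr) (use assms in auto)
  finally show ?thesis ..
qed

lemma conv_power_nonneg:
  assumes "\<And>x. a x \<ge> 0"
  shows "conv_power a k x \<ge> 0"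
  using assms
  by (induction a k arbitrary: x rule: conv_power.induct)
     (auto intro!: Bochner_Integration.integral_nonneg)

text \<open>The pointwise decay is spent on one factor and yields \<open>c\<close>. Each of the
  \<open>k\<close> convolutions then costs one exponential moment, since the triangle inequality
  splits the weight between \<open>x - y\<close> and \<open>y\<close>.\<close>

lemma conv_power_exp_bound:
  fixes a :: "real ^ 'n \<Rightarrow> real"
  assumes nonneg: "\<And>x. a x \<ge> 0"
    and even: "\<And>x. a (- x) = a x"
    and decay: "\<And>x. a x \<le> c * exp (- s * norm x)"
    and "s \<ge> 0"
    and int: "integrable lborel (\<lambda>y. a y * exp (s * norm y))"
  shows "conv_power a (Suc k) x
       \<le> c * (LINT y|lborel. a y * exp (s * norm y)) ^ k * exp (- s * norm x)"
proof (induction k arbitrary: x)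
  case 0
  then show ?case using decay by simp
next
  case (Suc k)
  let ?h = "\<lambda>y. a y * exp (s * norm y)"
  define M where "M = (LINT y|lborel. ?h y)"
  define C where "C = c * M ^ k * exp (- s * norm x)"
  have "M \<ge> 0"
    unfolding M_def using nonneg by simp
  moreover have "c \<ge> 0"
    using order.trans[OF nonneg[of 0] decay[of 0]] by simp
  ultimately have "C \<ge> 0"
    by (simp add: C_def)
  have meas: "?h \<in> borel_measurable borel"
    using borel_measurable_integrable[OF int] by simp
  have le: "a (x - y) * conv_power a (Suc k) y \<le> C * ?h (- x + y)" for y
  proof -
    \<comment> \<open>Evenness turns the reflected argument into a translated one, so that
      translation invariance of the Lebesgue measure suffices to evaluate the majorant.\<close>
    have sym: "a (x - y) = a (- x + y)" "norm (x - y) = norm (- x + y)"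
      using even[of "x - y"] by (simp_all add: norm_minus_commute)
    have "norm x \<le> norm (x - y) + norm y"
      by (metis norm_triangle_sub add.commute)
    then have "s * norm x \<le> s * norm (x - y) + s * norm y"
      using \<open>s \<ge> 0\<close> by (metis mult_left_mono distrib_left)
    then have "exp (- s * norm y) \<le> exp (- s * norm x) * exp (s * norm (x - y))"
      by (simp flip: exp_add)
    then have "a (x - y) * (c * M ^ k * exp (- s * norm y))
        \<le> a (x - y) * (c * M ^ k * (exp (- s * norm x) * exp (s * norm (x - y))))"
      using nonneg \<open>M \<ge> 0\<close> \<open>c \<ge> 0\<close> by (intro mult_left_mono) auto
    moreover have "a (x - y) * conv_power a (Suc k) y \<le> a (x - y) * (c * M ^ k * exp (- s * norm y))"
      using Suc.IH[of y] nonneg unfolding M_def by (intro mult_left_mono) auto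
    ultimately show ?thesis
      unfolding sym C_def by (simp add: mult_ac)
  qed
  \<comment> \<open>Integrability is supplied for the majorant alone: a left integrand that is not
    integrable would have Bochner integral 0, which the nonnegative majorant also dominates.\<close>
  have "conv_power a (Suc (Suc k)) x \<le> (LINT y|lborel. C * ?h (- x + y))"
    unfolding conv_power.simps
    using lborel_integrable_translation[OF int, of "- x"] le \<open>C \<ge> 0\<close> nonneg
    by (intro integral_mono') auto
  also have "\<dots> = C * M"
    using lborel_integral_translation[OF meas, of "- x"] by (simp add: M_def)
  finally show ?case
    by (simp add: C_def M_def mult_ac)
qed

text \<open>Termwise comparison with the geometric series of ratio \<open>M / (1 + lam)\<close>,
  which is below 1.\<close>

lemma resolvent_kernel_le:
  fixes a :: "real ^ 'n \<Rightarrow> real"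
  assumes nonneg: "\<And>x. a x \<ge> 0"
    and bound: "\<And>k x. conv_power a (Suc k) x \<le> c * M ^ k * exp (- s * norm x)"
    and "0 \<le> M" "M < 1 + lam"
  shows "resolvent_kernel a lam x \<le> c / (1 + lam - M) * exp (- s * norm x)"
proof -
  let ?E = "exp (- s * norm x)"
  let ?t = "\<lambda>k. conv_power a (Suc k) x / (1 + lam) ^ Suc k"
  have pos: "1 + lam > 0" using assms by simp
  have "(\<lambda>k. (M / (1 + lam)) ^ k) sums (1 / (1 - M / (1 + lam)))"
    using assms pos by (intro geometric_sums) auto
  then have "(\<lambda>k. c * ?E / (1 + lam) * (M / (1 + lam)) ^ k)
      sums (c * ?E / (1 + lam) * (1 / (1 - M / (1 + lam))))"
    by (rule sums_mult)
  also have "1 - M / (1 + lam) = (1 + lam - M) / (1 + lam)"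
    using pos by (simp add: diff_divide_distrib)
  also have "c * ?E / (1 + lam) * (1 / ((1 + lam - M) / (1 + lam))) = c / (1 + lam - M) * ?E"
    using pos by simp
  finally have sums: "(\<lambda>k. c * ?E / (1 + lam) * (M / (1 + lam)) ^ k) sums (c / (1 + lam - M) * ?E)" .
  have le: "?t k \<le> c * ?E / (1 + lam) * (M / (1 + lam)) ^ k" for k
    using divide_right_mono[OF bound[of k x], of "(1 + lam) ^ Suc k"] pos
    by (simp add: power_divide mult_ac)
  \<comment> \<open>Summability has to be proved, since the infinite sum of a divergent series is an
    unspecified value. Nonnegative terms turn the upper bound into a comparison of norms.\<close>
  have "norm (?t k) = ?t k" for k
    using conv_power_nonneg[of a, OF nonneg, of "Suc k"] pos by simp
  with le have "summable ?t"
    by (intro summable_comparison_test'[OF sums_summable[OF sums], of 0]) (simp only:)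
  then show ?thesis
    unfolding resolvent_kernel_def using le sums sums_le[OF le summable_sums sums] by simp
qed

text \<open>Dominated convergence along rates tending to 0. The same \<open>\<epsilon>\<close>
  limits the rate, for the linear bound on \<open>m\<close>, and the excess of the moment over the
  mass, for convergence of the geometric series.\<close>

lemma exp_moment_near_mass:
  fixes a :: "real ^ 'n \<Rightarrow> real"
  assumes nonneg: "\<And>x. a x \<ge> 0"
    and meas: "a \<in> borel_measurable borel"
    and "\<delta> > 0"
    and decay: "\<And>x. a x \<le> c * exp (- \<delta> * norm x)"
    and "\<epsilon> > 0"
  shows "\<exists>s>0. s < \<epsilon> \<and> s \<le> \<delta> \<and> integrable lborel (\<lambda>y. a y * exp (s * norm y)) \<and>
           (LINT y|lborel. a y * exp (s * norm y)) < (LINT y|lborel. a y) + \<epsilon>"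
proof -
  \<comment> \<open>All rates stay at or below \<open>\<delta> / 2\<close>, so half of the decay of
    \<open>a\<close> survives the weight and serves as a majorant uniform in
    \<open>n\<close>.\<close>
  define s where "s n = \<delta> / 2 * inverse (real (Suc n))" for n
  have s0: "s \<longlonglongrightarrow> 0"
    unfolding s_def by (rule tendsto_mult_right_zero[OF LIMSEQ_inverse_real_of_nat])
  have s_pos: "s n > 0" and s_le: "s n \<le> \<delta> / 2" for n
    using \<open>\<delta> > 0\<close> by (simp_all add: s_def field_simps)
  let ?w = "\<lambda>y. c * exp (- (\<delta> / 2) * norm (y :: real ^ 'n))"
  have w: "integrable lborel ?w"
    using integrable_exp_neg_norm[of "\<delta> / 2", where 'a="real ^ 'n"] \<open>\<delta> > 0\<close> by simp
  have dom: "norm (a y * exp (s n * norm y)) \<le> ?w y" for n y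
  proof -
    have "c \<ge> 0"
      using order.trans[OF nonneg[of 0] decay[of 0]] by simp
    have "a y * exp (s n * norm y) \<le> c * exp (- \<delta> * norm y) * exp (\<delta> / 2 * norm y)"
      using mult_right_mono[OF s_le, of "norm y"] \<open>c \<ge> 0\<close> by (intro mult_mono nonneg decay) auto
    also have "\<dots> = ?w y"
      by (simp flip: exp_add add: field_simps)
    finally show ?thesis
      using nonneg by simp
  qed
  have lim: "(\<lambda>n. a y * exp (s n * norm y)) \<longlonglongrightarrow> a y" for y
    using s0 by (auto intro!: tendsto_eq_intros)
  have int: "integrable lborel (\<lambda>y. a y * exp (s n * norm y))" for n
    using w by (rule Bochner_Integration.integrable_bound)
      (use meas dom order.trans[OF dom abs_ge_self] in auto)
  have "(\<lambda>n. LINT y|lborel. a y * exp (s n * norm y)) \<longlonglongrightarrow> (LINT y|lborel. a y)"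
    by (rule integral_dominated_convergence[OF _ _ w]) (use meas lim dom in auto)
  then have "\<forall>\<^sub>F n in sequentially. (LINT y|lborel. a y * exp (s n * norm y)) < (LINT y|lborel. a y) + \<epsilon>"
    by (rule order_tendstoD) (use \<open>\<epsilon> > 0\<close> in simp)
  moreover have "\<forall>\<^sub>F n in sequentially. s n < \<epsilon>"
    using order_tendstoD(2)[OF s0 \<open>\<epsilon> > 0\<close>] .
  ultimately have "\<forall>\<^sub>F n in sequentially.
      (LINT y|lborel. a y * exp (s n * norm y)) < (LINT y|lborel. a y) + \<epsilon> \<and> s n < \<epsilon>"
    by (rule eventually_conj)
  then obtain n where "(LINT y|lborel. a y * exp (s n * norm y)) < (LINT y|lborel. a y) + \<epsilon>" "s n < \<epsilon>"
    by (auto simp: eventually_sequentially)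
  moreover have "s n \<le> \<delta>"
    using s_le[of n] \<open>\<delta> > 0\<close> by linarith
  ultimately show ?thesis
    using s_pos int by blast
qed

theorem theorem2p2:
  fixes a :: "real ^ 'n \<Rightarrow> real" and c \<delta> :: real
  assumes nonneg: "\<And>x. a x \<ge> 0"
    and bounded: "bounded (range a)"
    and continuous: "continuous_on UNIV a"
    and even: "\<And>x. a (- x) = a x"
    and integrable: "integrable lborel a"
    and mass: "(LINT x|lborel. a x) = 1"
    and "c > 0" and "\<delta> > 0"
    and decay: "\<And>x. a x \<le> c * exp (- \<delta> * norm x)"
  shows "\<exists>k m :: real \<Rightarrow> real.
           (\<forall>lam>0. k lam > 0 \<and> m lam > 0) \<and>
           (\<forall>lam>0. \<forall>x. resolvent_kernel a lam x \<le> k lam * exp (- m lam * norm x)) \<and>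
           filterlim k at_top (at_right 0) \<and>
           m \<in> O[at_right 0](\<lambda>lam. lam)"
proof -
  have "\<exists>s>0. s < lam \<and> (\<forall>x. resolvent_kernel a lam x \<le> 2 * c / lam * exp (- s * norm x))"
    if "lam > 0" for lam
  proof -
    \<comment> \<open>Tolerance \<open>lam / 2\<close> leaves the gap \<open>1 + lam - M\<close>
      larger than \<open>lam / 2\<close>, whence the constant \<open>2 * c / lam\<close>.\<close>
    have "lam / 2 > 0"
      using that by simp
    have meas: "a \<in> borel_measurable borel"
      using borel_measurable_integrable[OF integrable] by simp
    obtain s where s: "s > 0" "s < lam / 2" "s \<le> \<delta>"
        and int: "integrable lborel (\<lambda>y. a y * exp (s * norm y))"
        and M: "(LINT y|lborel. a y * exp (s * norm y)) < 1 + lam / 2"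
      using exp_moment_near_mass[of a, OF nonneg meas \<open>\<delta> > 0\<close> decay \<open>lam / 2 > 0\<close>]
      unfolding mass by blast
    define M where "M = (LINT y|lborel. a y * exp (s * norm y))"
    have "0 \<le> M" "M < 1 + lam"
      using nonneg M that by (auto simp: M_def)
    have decay': "a x \<le> c * exp (- s * norm x)" for x
    proof -
      have "c * exp (- \<delta> * norm x) \<le> c * exp (- s * norm x)"
        using s \<open>c > 0\<close> by (intro mult_left_mono) (auto intro: mult_right_mono)
      with decay show ?thesis by (rule order.trans)
    qed
    have "resolvent_kernel a lam x \<le> 2 * c / lam * exp (- s * norm x)" for x
    proof -
      have "resolvent_kernel a lam x \<le> c / (1 + lam - M) * exp (- s * norm x)"
        using conv_power_exp_bound[of a, OF nonneg even decay' _ int] s \<open>0 \<le> M\<close> \<open>M < 1 + lam\<close>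
        by (intro resolvent_kernel_le nonneg) (auto simp: M_def)
      also have "c / (1 + lam - M) \<le> c / (lam / 2)"
        using M that \<open>c > 0\<close> by (intro divide_left_mono) (auto simp: M_def)
      finally show ?thesis by (simp add: mult_right_mono mult.commute)
    qed
    with s that show ?thesis by (intro exI[of _ s]) auto
  qed
  \<comment> \<open>The prefactor is explicit, whereas \<open>m\<close> is a pointwise choice of
    rates. The bound \<open>m lam < lam\<close> gives the order estimate with constant 1.\<close>
  then obtain m where m: "\<And>lam. lam > 0 \<Longrightarrow> m lam > 0 \<and> m lam < lam \<and>
      (\<forall>x. resolvent_kernel a lam x \<le> 2 * c / lam * exp (- m lam * norm x))"
    by metis
  have "filterlim (\<lambda>lam. 2 * c * inverse lam) at_top (at_right 0)"
    using \<open>c > 0\<close>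
    by (intro filterlim_tendsto_pos_mult_at_top[OF tendsto_const] filterlim_inverse_at_top_right) auto
  then have "filterlim (\<lambda>lam. 2 * c / lam) at_top (at_right 0)"
    by (simp add: divide_inverse)
  moreover have "m \<in> O[at_right 0](\<lambda>lam. lam)"
    by (rule bigoI[of _ 1], rule eventually_mono[OF eventually_at_right_less]) (use m in force)
  ultimately show ?thesis
    using m \<open>c > 0\<close> by (intro exI[of _ "\<lambda>lam. 2 * c / lam"] exI[of _ m]) auto
qed

end
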